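(* Assume the weak approximation property holds with constant $\eta_w>0$: for every $\mathbf v\in\mathbb R^n$ there is $\mathbf v_c\in\mathbb R^{n_c}$ with $\|\mathbf v-P\mathbf v_c\|_D\le\eta_w\|\mathbf v\|_A$. Suppose the eigenvalues of $A_f$ lie in $[\alpha,\beta]\subset[\frac1{\eta_w^2},1]$ with $\alpha<\beta$. Let $\nu\ge1$ and let $\widetilde P=(I-\widetilde\pi_f)P$ be defined with the Chebyshev polynomial $$p_\nu(t)=\frac{T_\nu\left(\frac{\beta+\alpha-2t}{\beta-\alpha}\right)}{T_\nu\left(\frac{\beta+\alpha}{\beta-\alpha}\right)}.$$ For $\mathbf f\in\mathbb R^n$ let $\mathbf u$ solve $A\mathbf u=\mathbf f$ and let $\widetilde{\mathbf u}_c\in\mathbb R^{n_c}$ solve $\widetilde P^TA\widetilde P\,\widetilde{\mathbf u}_c=\widetilde P^T\mathbf f$. Then, with $q=\frac{\eta_w-1}{\eta_w+1}$, $$\|\mathbf u-\widetilde P\widetilde{\mathbf u}_c\|_A\le\eta_w\|D^{-\frac12}A\mathbf u\|+\frac{2q^\nu\eta_w}{1+q^{2\nu}}\|\mathbf u\|_A.$$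
   Context: $A\in\mathbb R^{n\times n}$ is symmetric positive definite (SPD), and $D\in\mathbb R^{n\times n}$ is a diagonal SPD matrix with $\mathbf v^TA\mathbf v\le\mathbf v^TD\mathbf v$ for all $\mathbf v\in\mathbb R^n$. For an SPD matrix $B$, $\|\mathbf v\|_B=\sqrt{\mathbf v^TB\mathbf v}$; $\|\cdot\|$ is the Euclidean norm. The index set $\{1,\dots,n\}$ is partitioned into nonoverlapping aggregates $\mathcal A_1,\dots,\mathcal A_{n_a}$. The prolongation $P\in\mathbb R^{n\times n_c}$, of full column rank with $1\le n_c<n$, is block diagonal with respect to this partition, with blocks $P_{\mathcal A_i}$ (rows indexed by $\mathcal A_i$). On each aggregate, let $D_{\mathcal A_i}=D|_{\mathcal A_i}$ and choose vectors that are orthonormal with respect to $D_{\mathcal A_i}$ and span the $D_{\mathcal A_i}$-orthogonal complement of $\operatorname{Range}(P_{\mathcal A_i})$. Extended by zero outside $\mathcal A_i$, these vectors (for all $i$) are the columns of $P_\perp\in\mathbb R^{n\times(n-n_c)}$. Thus $P_\perp^TDP=0$ and $P_\perp^TDP_\perp=I$. Define $A_f=P_\perp^TAP_\perp$. $T_k$ denotes the Chebyshev polynomial of the first kind of degree $k$. Given a polynomial $p_\nu$ of degree $\nu$ with $p_\nu(0)=1$, write $p_\nu(t)=1-t\,q_{\nu-1}(t)$ with $q_{\nu-1}$ a polynomial of degree $\nu-1$, and set $\widetilde A_f^{-1}:=q_{\nu-1}(A_f)$ and $\widetilde\pi_f:=P_\perp\widetilde A_f^{-1}P_\perp^TA$.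 *)

theory Defs
  imports
    "HOL-Analysis.Analysis"
    "HOL-Computational_Algebra.Polynomial"
    "HOL-Library.Disjoint_Sets"
begin

definition spd :: "real^'n^'n \<Rightarrow> bool" where
  "spd B \<longleftrightarrow> transpose B = B \<and> (\<forall>v. v \<noteq> 0 \<longrightarrow> v \<bullet> (B *v v) > 0)"

definition is_diagonal :: "real^'n^'n \<Rightarrow> bool" where
  "is_diagonal B \<longleftrightarrow> (\<forall>i j. i \<noteq> j \<longrightarrow> B $ i $ j = 0)"

definition mat_norm :: "real^'n^'n \<Rightarrow> real^'n \<Rightarrow> real" where
  "mat_norm B v = sqrt (v \<bullet> (B *v v))"

text \<open>The matrix $D^{-1/2}$, for \<open>D\<close> diagonal with positive diagonal entries only.\<close>

definition diag_inv_sqrt :: "real^'n^'n \<Rightarrow> real^'n^'n" where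
  "diag_inv_sqrt D = (\<chi> i j. if i = j then 1 / sqrt (D $ i $ i) else 0)"

definition is_eigenvalue :: "real^'n^'n \<Rightarrow> real \<Rightarrow> bool" where
  "is_eigenvalue B \<mu> \<longleftrightarrow> (\<exists>v. v \<noteq> 0 \<and> B *v v = \<mu> *\<^sub>R v)"

text \<open>The operations \<open>*\<close> and \<open>^\<close> on \<open>real^'n^'n\<close> are componentwise, so powers of a
  matrix are built from \<open>**\<close>.\<close>

definition mat_pow :: "real^'n^'n \<Rightarrow> nat \<Rightarrow> real^'n^'n" where
  "mat_pow M k = (((**) M) ^^ k) (mat 1)"

definition poly_mat :: "real poly \<Rightarrow> real^'n^'n \<Rightarrow> real^'n^'n" where
  "poly_mat p M = (\<Sum>k\<le>degree p. coeff p k *\<^sub>R mat_pow M k)"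

fun cheb :: "nat \<Rightarrow> real poly" where
  "cheb 0 = 1"
| "cheb (Suc 0) = [:0, 1:]"
| "cheb (Suc (Suc n)) = [:0, 2:] * cheb (Suc n) - cheb n"

definition cheb_scaled :: "nat \<Rightarrow> real \<Rightarrow> real \<Rightarrow> real poly" where
  "cheb_scaled \<nu> \<alpha> \<beta> =
     smult (1 / poly (cheb \<nu>) ((\<beta> + \<alpha>) / (\<beta> - \<alpha>)))
       (pcompose (cheb \<nu>) [:(\<beta> + \<alpha>) / (\<beta> - \<alpha>), - 2 / (\<beta> - \<alpha>):])"

lemma poly_cheb_scaled:
  "poly (cheb_scaled \<nu> \<alpha> \<beta>) t =
     poly (cheb \<nu>) ((\<beta> + \<alpha> - 2 * t) / (\<beta> - \<alpha>)) / poly (cheb \<nu>) ((\<beta> + \<alpha>) / (\<beta> - \<alpha>))"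
  by (simp add: cheb_scaled_def poly_pcompose diff_divide_distrib mult.commute)

text \<open>Vectors on an aggregate \<open>S\<close> are represented by their extension by zero to \<open>real^'n\<close>.
  The inner product of the restrictions of \<open>x\<close> and \<open>y\<close> to \<open>S\<close> is taken with respect to the
  principal submatrix of \<open>D\<close> with rows and columns in \<open>S\<close>.\<close>

definition local_inner :: "real^'n^'n \<Rightarrow> 'n set \<Rightarrow> real^'n \<Rightarrow> real^'n \<Rightarrow> real" where
  "local_inner D S x y = (\<Sum>i\<in>S. \<Sum>j\<in>S. x $ i * D $ i $ j * y $ j)"

definition local_complement :: "real^'n^'n \<Rightarrow> 'n set \<Rightarrow> (real^'n) set \<Rightarrow> (real^'n) set" where
  "local_complement D S W =
     {v. (\<forall>i. i \<notin> S \<longrightarrow> v $ i = 0) \<and> (\<forall>w\<in>W. local_inner D S v w = 0)}"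

text \<open>The map \<open>blk\<close> assigns to each column index the aggregate of the diagonal block to which
  the column belongs; the columns need not be ordered by aggregate.\<close>

definition block_diagonal :: "'n set set \<Rightarrow> ('c \<Rightarrow> 'n set) \<Rightarrow> real^'c^'n \<Rightarrow> bool" where
  "block_diagonal \<A> blk M \<longleftrightarrow>
     (\<forall>j. blk j \<in> \<A> \<and> (\<forall>i. i \<notin> blk j \<longrightarrow> M $ i $ j = 0))"

definition block_columns :: "('c \<Rightarrow> 'n set) \<Rightarrow> real^'c^'n \<Rightarrow> 'n set \<Rightarrow> (real^'n) set" where
  "block_columns blk M S = {column j M | j. blk j = S}"

text \<open>The columns of \<open>Pp\<close> attached to an aggregate \<open>S\<close> are orthonormal and span the orthogonal
  complement of the range of the block of \<open>P\<close> on \<open>S\<close>, both with respect to the restriction of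
  \<open>D\<close> to \<open>S\<close>.\<close>

definition aggregate_complement ::
  "'n set set \<Rightarrow> ('c \<Rightarrow> 'n set) \<Rightarrow> ('f \<Rightarrow> 'n set) \<Rightarrow>
     real^'n^'n \<Rightarrow> real^'c^'n \<Rightarrow> real^'f^'n \<Rightarrow> bool" where
  "aggregate_complement \<A> cblk fblk D P Pp \<longleftrightarrow>
     block_diagonal \<A> fblk Pp \<and>
     (\<forall>S\<in>\<A>.
        (\<forall>j k. fblk j = S \<longrightarrow> fblk k = S \<longrightarrow>
           local_inner D S (column j Pp) (column k Pp) = (if j = k then 1 else 0)) \<and>
        span (block_columns fblk Pp S) = local_complement D S (span (block_columns cblk P S)))"

definition fine_matrix :: "real^'n^'n \<Rightarrow> real^'f^'n \<Rightarrow> real^'f^'f" where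
  "fine_matrix A Pp = transpose Pp ** A ** Pp"

text \<open>The matrix $\widetilde\pi_f$, in which \<open>poly_mat q A\<^sub>f\<close> approximates the inverse of
  \<open>A\<^sub>f = fine_matrix A Pp\<close>.\<close>

definition approx_proj :: "real^'n^'n \<Rightarrow> real^'f^'n \<Rightarrow> real poly \<Rightarrow> real^'n^'n" where
  "approx_proj A Pp q = Pp ** poly_mat q (fine_matrix A Pp) ** transpose Pp ** A"

definition approx_ideal_prolongation ::
  "real^'n^'n \<Rightarrow> real^'c^'n \<Rightarrow> real^'f^'n \<Rightarrow> real poly \<Rightarrow> real^'c^'n" where
  "approx_ideal_prolongation A P Pp q = (mat 1 - approx_proj A Pp q) ** P"

definition weak_approximation ::
  "real^'n^'n \<Rightarrow> real^'n^'n \<Rightarrow> real^'c^'n \<Rightarrow> real \<Rightarrow> bool" where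
  "weak_approximation A D P \<eta> \<longleftrightarrow>
     (\<forall>v. \<exists>v\<^sub>c. mat_norm D (v - P *v v\<^sub>c) \<le> \<eta> * mat_norm A v)"

end

theory Submission
  imports Defs
begin

text \<open>The Galerkin solution is the best approximation to \<open>u\<close> from the range of \<open>Pt\<close> in the
  \<open>A\<close>-norm (\<open>galerkin_optimal\<close>), so any element of that range bounds the error. Write
  \<open>u = P a + Q b\<close>, where \<open>Q\<close> denotes \<open>Pp\<close>; this is possible because the columns of \<open>P\<close> and \<open>Q\<close>
  together form a basis (\<open>fine_coarse_decomposition\<close>). The element used is \<open>Pt a\<close>.

  Let \<open>M = Q\<^sup>T A Q\<close> and let \<open>g\<close>, \<open>g'\<close> solve \<open>M g = Q\<^sup>T A u\<close> and \<open>M g' = Q\<^sup>T A P a\<close>, so that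
  \<open>Q g\<close> and \<open>Q g'\<close> are the \<open>A\<close>-orthogonal projections of \<open>u\<close> and \<open>P a\<close> to the range of \<open>Q\<close>,
  and \<open>g = g' + b\<close>. Since \<open>q(M) M = I - p(M)\<close>, the error splits as
  \<open>u - Pt a = Q g - Q p(M) g'\<close>: the error of exact projection, plus the effect of replacing
  the inverse of \<open>M\<close> by \<open>q(M)\<close>. The two parts are bounded separately
  (\<open>approx_ideal_prolongation_bound\<close>).

  For the first, the eigenvalues of \<open>M\<close> are at least \<open>1 / \<eta>\<^sup>2\<close>, whence
  \<open>\<parallel>Q g\<parallel>\<^sub>A \<le> \<eta> \<parallel>Q\<^sup>T A u\<parallel>\<close>, and \<open>D\<close>-orthonormality of the columns of \<open>Q\<close> bounds \<open>\<parallel>Q\<^sup>T A u\<parallel>\<close> by the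
  norm of \<open>A u\<close> dual to \<open>\<parallel>\<cdot>\<parallel>\<^sub>D\<close>.

  For the second, \<open>p(M)\<close> contracts the \<open>M\<close>-norm by the maximum of \<open>\<bar>p\<bar>\<close> on the spectrum, and it
  remains to show \<open>\<parallel>Q g'\<parallel>\<^sub>A \<le> \<eta> \<parallel>u\<parallel>\<^sub>A\<close>. The vector \<open>x = u - Q g = P a - Q g'\<close> is
  \<open>A\<close>-orthogonal to the range of \<open>Q\<close>, so \<open>\<parallel>x\<parallel>\<^sub>A \<le> \<parallel>u\<parallel>\<^sub>A\<close>; on the other hand \<open>P a\<close> is the
  \<open>D\<close>-orthogonal projection of \<open>x\<close> to the range of \<open>P\<close>, so \<open>\<parallel>Q g'\<parallel>\<^sub>D\<close> is the \<open>D\<close>-distance of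
  \<open>x\<close> from that range, and weak approximation applies to \<open>x\<close>.

  Both spectral bounds follow from one principle, \<open>poly_mat_nonneg\<close>: a polynomial that is
  nonnegative on the spectrum of a symmetric matrix gives a positive semidefinite matrix.
  The Chebyshev polynomials enter through \<open>abs_poly_cheb_scaled_le\<close>, where the substitution
  \<open>(s + 1 / s) / 2\<close> makes the normalising constant explicit.\<close>

section \<open>Symmetric matrices and their polynomials\<close>

lemma inner_transpose_mult:
  fixes M :: "real^'m^'n"
  shows "(transpose M *v x) \<bullet> y = x \<bullet> (M *v y)"
  by (simp add: dot_lmul_matrix)

lemma inner_range_eq_0:
  fixes M :: "real^'m^'n"
  assumes "transpose M *v z = 0"
  shows "(M *v y) \<bullet> z = 0"
proof -
  have "(M *v y) \<bullet> z = (transpose M *v z) \<bullet> y"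
    by (subst inner_commute) (rule inner_transpose_mult[symmetric])
  then show ?thesis by (simp only: assms inner_zero_left)
qed

lemma inner_symmetric_mult:
  fixes M :: "real^'n^'n"
  assumes "transpose M = M"
  shows "(M *v x) \<bullet> y = x \<bullet> (M *v y)"
  using inner_transpose_mult[of M x y] assms by simp

lemma poly_mat_mult_vector:
  fixes M :: "real^'n^'n"
  assumes "degree p \<le> n"
  shows "poly_mat p M *v x = (\<Sum>k\<le>n. coeff p k *\<^sub>R (mat_pow M k *v x))"
proof -
  have "poly_mat p M = (\<Sum>k\<le>n. coeff p k *\<^sub>R mat_pow M k)"
    unfolding poly_mat_def using assms
    by (intro sum.mono_neutral_left) (auto simp: coeff_eq_0)
  moreover have "linear (\<lambda>B :: real^'n^'n. B *v x)"
    by (rule linearI) (simp_all add: matrix_vector_mult_add_rdistrib scaleR_matrix_vector_assoc)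
  ultimately show ?thesis
    by (simp add: linear_sum[where f = "\<lambda>B. B *v x"] scaleR_matrix_vector_assoc)
qed

lemma poly_mat_0 [simp]: "poly_mat 0 M *v x = 0"
  by (simp add: poly_mat_def)

text \<open>Horner's rule: the algebra of matrix polynomials then follows by induction along \<open>pCons\<close>
  without reference to degrees.\<close>

lemma poly_mat_pCons:
  "poly_mat (pCons a p) M *v x = a *\<^sub>R x + M *v (poly_mat p M *v x)"
proof -
  have Suc: "mat_pow M (Suc k) *v x = M *v (mat_pow M k *v x)" for k
    by (simp add: mat_pow_def matrix_vector_mul_assoc)
  have "poly_mat (pCons a p) M *v x
      = (\<Sum>k\<le>Suc (degree p). coeff (pCons a p) k *\<^sub>R (mat_pow M k *v x))"
    by (rule poly_mat_mult_vector) (simp add: degree_pCons_le)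
  also have "\<dots> = a *\<^sub>R x + (\<Sum>k\<le>degree p. coeff p k *\<^sub>R (M *v (mat_pow M k *v x)))"
    unfolding sum.atMost_Suc_shift Suc by (simp add: mat_pow_def)
  also have "(\<Sum>k\<le>degree p. coeff p k *\<^sub>R (M *v (mat_pow M k *v x))) = M *v (poly_mat p M *v x)"
    by (simp add: poly_mat_mult_vector[OF order_refl] linear_sum[OF matrix_vector_mul_linear]
        matrix_vector_mult_scaleR)
  finally show ?thesis .
qed

lemma poly_mat_add: "poly_mat (p + q) M *v x = poly_mat p M *v x + poly_mat q M *v x"
  by (induction p q rule: poly_induct2)
     (simp_all add: poly_mat_pCons matrix_vector_right_distrib scaleR_add_left)

lemma poly_mat_smult: "poly_mat (smult c p) M *v x = c *\<^sub>R (poly_mat p M *v x)"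
  by (induction p) (simp_all add: poly_mat_pCons matrix_vector_mult_scaleR scaleR_add_right)

lemma poly_mat_diff: "poly_mat (p - q) M *v x = poly_mat p M *v x - poly_mat q M *v x"
  using poly_mat_add[of p "smult (-1) q" M x] by (simp add: poly_mat_smult[of "-1", simplified])

lemma poly_mat_mult: "poly_mat (p * q) M *v x = poly_mat p M *v (poly_mat q M *v x)"
  by (induction p) (simp_all add: poly_mat_pCons poly_mat_add poly_mat_smult)

lemma poly_mat_X: "poly_mat [:0, 1:] M *v x = M *v x"
  by (simp add: poly_mat_pCons)

lemma poly_mat_const: "poly_mat [:c:] M *v x = c *\<^sub>R x"
  by (simp add: poly_mat_pCons)

lemma poly_mat_1: "poly_mat 1 M *v x = x"
  using poly_mat_const[of 1 M x] by (simp add: one_pCons)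

lemma poly_mat_commute: "poly_mat p M *v (M *v x) = M *v (poly_mat p M *v x)"
  using poly_mat_mult[of p "[:0, 1:]" M x] poly_mat_mult[of "[:0, 1:]" p M x]
  by (simp add: poly_mat_X mult.commute)

lemma transpose_poly_mat:
  assumes "transpose M = M"
  shows "transpose (poly_mat p M) = poly_mat p M"
proof -
  have "(poly_mat p M *v x) \<bullet> y = x \<bullet> (poly_mat p M *v y)" for x y
  proof (induction p arbitrary: x y)
    case (pCons a p)
    then show ?case
      by (simp add: poly_mat_pCons inner_add_left inner_add_right
          inner_symmetric_mult[OF assms] poly_mat_commute)
  qed simp
  then have "(transpose (poly_mat p M) *v x) \<bullet> y = (poly_mat p M *v x) \<bullet> y" for x y
    by (simp only: inner_transpose_mult)
  then have "transpose (poly_mat p M) *v x = poly_mat p M *v x" for x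
    by (metis vector_eq_rdot)
  then show ?thesis
    by (simp only: matrix_eq) simp
qed

lemma poly_mat_eigenvector:
  assumes "M *v v = \<mu> *\<^sub>R v"
  shows "poly_mat p M *v v = poly p \<mu> *\<^sub>R v"
  by (induction p)
     (simp_all add: poly_mat_pCons matrix_vector_mult_scaleR assms scaleR_add_left mult.commute)

section \<open>Positivity of polynomials on the spectrum\<close>

text \<open>A zero of a nonnegative quadratic form is a minimum, so the first variation of the form
  vanishes there. Varying only in the direction \<open>N v\<close>, which stays in \<open>S\<close> by invariance,
  already shows that \<open>N v\<close> has length zero.\<close>

lemma nonneg_quadratic_form_kernel:
  fixes N :: "real^'n^'n"
  assumes sym: "transpose N = N" and S: "subspace S" "\<And>x. x \<in> S \<Longrightarrow> N *v x \<in> S"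
    and nonneg: "\<And>x. x \<in> S \<Longrightarrow> 0 \<le> x \<bullet> (N *v x)"
    and v: "v \<in> S" "v \<bullet> (N *v v) = 0"
  shows "N *v v = 0"
proof -
  let ?w = "N *v v"
  define c where "c = ?w \<bullet> ?w"
  define d where "d = ?w \<bullet> (N *v ?w)"
  have wS: "?w \<in> S" using S v by blast
  have d: "0 \<le> d" using nonneg[OF wS] by (simp add: d_def)
  have c: "0 \<le> c" by (simp add: c_def)
  have q: "0 \<le> 2 * t * c + t\<^sup>2 * d" for t
  proof -
    have "v + t *\<^sub>R ?w \<in> S" by (intro subspace_add subspace_scale S v wS)
    from nonneg[OF this] show ?thesis
      using v(2) inner_symmetric_mult[OF sym, of v ?w]
      by (simp add: c_def d_def matrix_vector_right_distrib matrix_vector_mult_scaleR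
          inner_add_left inner_add_right power2_eq_square algebra_simps)
  qed
  have "c = 0"
  proof (rule ccontr)
    assume "c \<noteq> 0"
    with c have "0 < c" by simp
    \<comment> \<open>The step \<open>t = - k c\<close> is short enough that the linear term outweighs the quadratic one.\<close>
    define k where "k = 1 / (d + 1)"
    have k: "0 < k" "k * d \<le> 1" using d by (simp_all add: k_def)
    have "2 * (- k * c) * c + (- k * c)\<^sup>2 * d = (k * c\<^sup>2) * (k * d - 2)"
      by (simp add: algebra_simps power2_eq_square)
    also have "\<dots> < 0" using k \<open>0 < c\<close> by (intro mult_pos_neg) auto
    finally show False using q[of "- k * c"] by linarith
  qed
  then show ?thesis by (simp add: c_def)
qed

text \<open>The Rayleigh quotient attains its minimum on the compact unit sphere of \<open>S\<close>. Subtracting the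
  minimal value \<open>\<mu>\<close> from \<open>M\<close> gives a form that is nonnegative on \<open>S\<close> and vanishes at the
  minimiser, which therefore is an eigenvector. Invariant subspaces are admitted because the
  lemma is applied to eigenspaces of a matrix commuting with \<open>M\<close>.\<close>

lemma least_eigenvector:
  fixes M :: "real^'n^'n"
  assumes sym: "transpose M = M" and S: "subspace S" "\<And>x. x \<in> S \<Longrightarrow> M *v x \<in> S"
    and "y \<in> S" "y \<noteq> 0"
  obtains v \<mu> where "v \<in> S" "v \<noteq> 0" "M *v v = \<mu> *\<^sub>R v" "\<And>x. x \<in> S \<Longrightarrow> \<mu> * (x \<bullet> x) \<le> x \<bullet> (M *v x)"
proof -
  let ?K = "S \<inter> sphere 0 1"
  have "compact ?K"
    by (intro closed_Int_compact closed_subspace S compact_sphere)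
  moreover have "(1 / norm y) *\<^sub>R y \<in> ?K"
    using assms by (simp add: subspace_scale)
  then have "?K \<noteq> {}" by blast
  moreover have "continuous_on ?K (\<lambda>x. x \<bullet> (M *v x))"
    by (intro continuous_intros linear_continuous_on_compose matrix_vector_mul_linear)
  ultimately obtain v where v: "v \<in> ?K" "\<And>x. x \<in> ?K \<Longrightarrow> v \<bullet> (M *v v) \<le> x \<bullet> (M *v x)"
    using continuous_attains_inf[of ?K "\<lambda>x. x \<bullet> (M *v x)"] by blast
  define \<mu> where "\<mu> = v \<bullet> (M *v v)"
  have bound: "\<mu> * (x \<bullet> x) \<le> x \<bullet> (M *v x)" if "x \<in> S" for x
  proof (cases "x = 0")
    case False
    have "(1 / norm x) *\<^sub>R x \<in> ?K" using False that S by (simp add: subspace_scale)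
    from v(2)[OF this] have "\<mu> \<le> (x \<bullet> (M *v x)) / (norm x)\<^sup>2"
      by (simp add: \<mu>_def matrix_vector_mult_scaleR power2_eq_square)
    then show ?thesis using False by (simp add: field_simps dot_square_norm)
  qed simp
  define N where "N = M - \<mu> *\<^sub>R mat 1"
  have N: "N *v x = M *v x - \<mu> *\<^sub>R x" for x
    by (simp add: N_def matrix_vector_mult_diff_rdistrib scaleR_matrix_vector_assoc[symmetric])
  have symN: "transpose N = N"
    using sym by (simp add: N_def transpose_def mat_def vec_eq_iff)
  have vv: "v \<bullet> v = 1" using v(1) by (simp add: dot_square_norm)
  have "N *v v = 0"
    by (rule nonneg_quadratic_form_kernel[OF symN S(1)])
       (use v(1) vv S bound in \<open>auto simp: N inner_diff_right \<mu>_def subspace_diff subspace_scale\<close>)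
  then have "M *v v = \<mu> *\<^sub>R v" by (simp add: N)
  moreover have "v \<noteq> 0" using vv by auto
  ultimately show ?thesis using that v(1) bound by blast
qed

text \<open>Two uses of the Rayleigh quotient replace a diagonalisation of \<open>M\<close>. The minimum \<open>\<kappa>\<close> of the
  Rayleigh quotient of \<open>h(M)\<close> is an eigenvalue of \<open>h(M)\<close>, and its eigenspace is invariant
  under \<open>M\<close>, since \<open>M\<close> commutes with \<open>h(M)\<close>. An eigenvector of \<open>M\<close> inside that eigenspace,
  with eigenvalue \<open>\<mu>\<close>, shows \<open>\<kappa> = h(\<mu>) \<ge> 0\<close>.\<close>

lemma poly_mat_nonneg:
  fixes M :: "real^'n^'n"
  assumes sym: "transpose M = M" and nonneg: "\<And>\<mu>. is_eigenvalue M \<mu> \<Longrightarrow> 0 \<le> poly h \<mu>"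
  shows "0 \<le> x \<bullet> (poly_mat h M *v x)"
proof -
  let ?H = "poly_mat h M"
  obtain y :: "real^'n" where "y \<noteq> 0" using zero_neq_one by blast
  then obtain v \<kappa> where v: "v \<noteq> 0" "?H *v v = \<kappa> *\<^sub>R v"
    and low: "\<And>x. \<kappa> * (x \<bullet> x) \<le> x \<bullet> (?H *v x)"
    using least_eigenvector[OF transpose_poly_mat[OF sym, of h], of UNIV y] by auto
  let ?E = "{z. ?H *v z = \<kappa> *\<^sub>R z}"
  have E: "subspace ?E"
    by (auto simp: subspace_def matrix_vector_right_distrib matrix_vector_mult_scaleR
        scaleR_add_right mult.commute)
  have inv: "M *v z \<in> ?E" if "z \<in> ?E" for z
    using that by (simp add: poly_mat_commute matrix_vector_mult_scaleR)
  obtain w \<mu> where w: "w \<in> ?E" "w \<noteq> 0" "M *v w = \<mu> *\<^sub>R w"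
    by (rule least_eigenvector[OF sym E inv, of v]) (use v in auto)
  have "\<kappa> *\<^sub>R w = poly h \<mu> *\<^sub>R w"
    using w poly_mat_eigenvector[OF w(3)] by simp
  then have "\<kappa> = poly h \<mu>" using w(2) by simp
  moreover have "0 \<le> poly h \<mu>" using nonneg w unfolding is_eigenvalue_def by blast
  ultimately have "0 \<le> \<kappa> * (x \<bullet> x)" by simp
  also have "\<dots> \<le> x \<bullet> (?H *v x)" by (rule low)
  finally show ?thesis .
qed

section \<open>Chebyshev polynomials\<close>

lemma poly_cheb_cos: "poly (cheb n) (cos \<theta>) = cos (n * \<theta>)"
proof (induction n rule: cheb.induct)
  case (3 n)
  have "cos ((real n + 1) * \<theta> + \<theta>) + cos ((real n + 1) * \<theta> - \<theta>)
      = 2 * cos \<theta> * cos ((real n + 1) * \<theta>)"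
    by (simp add: cos_add cos_diff)
  moreover have "(real n + 1) * \<theta> + \<theta> = real (Suc (Suc n)) * \<theta>"
      "(real n + 1) * \<theta> - \<theta> = real n * \<theta>" "real n + 1 = real (Suc n)"
    by (simp_all add: algebra_simps)
  ultimately show ?case using 3 by simp
qed simp_all

lemma abs_poly_cheb_le_1: "\<bar>x\<bar> \<le> 1 \<Longrightarrow> \<bar>poly (cheb n) x\<bar> \<le> 1"
  using poly_cheb_cos[of n "arccos x"] by (simp add: cos_arccos_abs)

text \<open>Outside \<open>[-1, 1]\<close> the Joukowski parametrisation plays the part of the cosine:
  the recurrence at \<open>(s + 1 / s) / 2\<close> has the solutions \<open>s\<^sup>n\<close> and \<open>s\<^sup>-\<^sup>n\<close>.\<close>

lemma poly_cheb_joukowski: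
  assumes "s \<noteq> 0"
  shows "poly (cheb n) ((s + 1 / s) / 2) = (s ^ n + 1 / s ^ n) / 2"
proof (induction n rule: cheb.induct)
  case (3 n)
  have "poly (cheb (Suc (Suc n))) ((s + 1 / s) / 2)
      = (s + 1 / s) * ((s ^ Suc n + 1 / s ^ Suc n) / 2) - (s ^ n + 1 / s ^ n) / 2"
    unfolding cheb.simps poly_diff poly_mult 3 by simp
  also have "\<dots> = (s ^ Suc (Suc n) + 1 / s ^ Suc (Suc n)) / 2"
    using assms by (simp add: divide_simps) (simp add: algebra_simps)
  finally show ?case .
qed simp_all

text \<open>On \<open>[\<alpha>, \<beta>]\<close> the numerator is at most 1 in modulus, so the bound is the reciprocal of the
  denominator. The latter is evaluated at the Joukowski image of
  \<open>s = (\<surd>\<beta> - \<surd>\<alpha>) / (\<surd>\<beta> + \<surd>\<alpha>)\<close>, which gives \<open>2 s\<^sup>n / (1 + s\<^sup>2\<^sup>n)\<close>. The condition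
  \<open>1 / \<eta>\<^sup>2 \<le> \<alpha> < \<beta> \<le> 1\<close> bounds the condition number \<open>\<beta> / \<alpha>\<close> by \<open>\<eta>\<^sup>2\<close>, hence \<open>s \<le> r < 1\<close>,
  and \<open>2 x / (1 + x\<^sup>2)\<close> increases on \<open>[0, 1]\<close>.\<close>

lemma abs_poly_cheb_scaled_le:
  assumes \<eta>: "\<eta> > 0" and ab: "\<alpha> < \<beta>" "1 / \<eta>\<^sup>2 \<le> \<alpha>" "\<beta> \<le> 1" and t: "\<alpha> \<le> t" "t \<le> \<beta>"
    and r: "r = (\<eta> - 1) / (\<eta> + 1)"
  shows "\<bar>poly (cheb_scaled n \<alpha> \<beta>) t\<bar> \<le> 2 * r ^ n / (1 + r ^ (2 * n))"
proof -
  define a b s where "a = sqrt \<alpha>" and "b = sqrt \<beta>" and "s = (b - a) / (b + a)"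
  have "0 < 1 / \<eta>\<^sup>2" using \<eta> by simp
  then have "0 < \<alpha>" using ab by linarith
  then have a: "0 < a" and "a < b" and \<alpha>: "\<alpha> = a\<^sup>2" and \<beta>: "\<beta> = b\<^sup>2"
    using ab by (auto simp: a_def b_def)
  have b: "b \<le> 1" using ab by (simp add: b_def)
  have "(1 / \<eta>)\<^sup>2 \<le> a\<^sup>2" using ab \<alpha> by (simp add: power_divide)
  then have "1 / \<eta> \<le> a" using a by (rule power2_le_imp_le[OF _ less_imp_le])
  then have \<eta>a: "1 \<le> \<eta> * a" using \<eta> by (simp add: field_simps)
  have s: "0 < s" "s < 1" using a \<open>a < b\<close> by (simp_all add: s_def)
  have "(b - a) * (\<eta> + 1) \<le> (\<eta> - 1) * (b + a)"
    using b \<eta>a by (simp add: algebra_simps)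
  then have sr: "s \<le> r"
    unfolding s_def r using a \<open>a < b\<close> \<eta>
    by (simp add: pos_divide_le_eq pos_le_divide_eq del: distrib_left_numeral)
  have r1: "r < 1" using \<eta> r by simp
  have J: "(\<beta> + \<alpha>) / (\<beta> - \<alpha>) = (s + 1 / s) / 2"
  proof -
    have nz: "b + a \<noteq> 0" "b - a \<noteq> 0" using a \<open>a < b\<close> by auto
    have "b\<^sup>2 - a\<^sup>2 = (b - a) * (b + a)" by (simp add: power2_eq_square algebra_simps)
    then show ?thesis unfolding s_def \<alpha> \<beta> using nz
      by (simp add: divide_simps) (simp add: power2_eq_square algebra_simps)
  qed
  have T: "poly (cheb n) ((\<beta> + \<alpha>) / (\<beta> - \<alpha>)) = (1 + s ^ (2 * n)) / (2 * s ^ n)"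
  proof -
    have *: "(y + 1 / y) / 2 = (1 + y\<^sup>2) / (2 * y)" if "0 < y" for y :: real
      using that by (simp add: field_simps power2_eq_square)
    have "s \<noteq> 0" "0 < s ^ n" using s by auto
    then show ?thesis
      unfolding J poly_cheb_joukowski[OF \<open>s \<noteq> 0\<close>] *[OF \<open>0 < s ^ n\<close>]
      by (simp add: power_mult[symmetric] mult.commute)
  qed
  have "\<bar>(\<beta> + \<alpha> - 2 * t) / (\<beta> - \<alpha>)\<bar> \<le> 1"
    using ab t by (auto simp: abs_le_iff divide_simps)
  then have "\<bar>poly (cheb n) ((\<beta> + \<alpha> - 2 * t) / (\<beta> - \<alpha>))\<bar> \<le> 1"
    by (rule abs_poly_cheb_le_1)
  moreover have Tpos: "0 < (1 + s ^ (2 * n)) / (2 * s ^ n)"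
    using s by (simp add: add_pos_pos)
  ultimately have "\<bar>poly (cheb_scaled n \<alpha> \<beta>) t\<bar> \<le> 1 / ((1 + s ^ (2 * n)) / (2 * s ^ n))"
    unfolding poly_cheb_scaled T by (subst abs_divide) (simp only: abs_of_pos divide_right_mono less_imp_le)
  also have "\<dots> = 2 * s ^ n / (1 + (s ^ n)\<^sup>2)"
    by (simp add: power_mult[symmetric] mult.commute)
  also have "\<dots> \<le> 2 * r ^ n / (1 + (r ^ n)\<^sup>2)"
  proof -
    define x y where "x = s ^ n" and "y = r ^ n"
    have "0 < x" "x \<le> y" "y \<le> 1"
      using s sr r1 by (auto simp: x_def y_def intro: power_mono power_le_one)
    \<comment> \<open>Cross-multiplying the claim and collecting terms leaves exactly this product.\<close>
    then have "0 \<le> (y - x) * (1 - x * y)"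
      by (intro mult_nonneg_nonneg) (auto intro: mult_le_one)
    then have "x * (1 + y\<^sup>2) \<le> y * (1 + x\<^sup>2)"
      by (simp add: power2_eq_square algebra_simps)
    moreover have "0 < 1 + x\<^sup>2" "0 < 1 + y\<^sup>2" by (simp_all add: add_pos_nonneg)
    ultimately show ?thesis
      unfolding x_def[symmetric] y_def[symmetric] by (simp add: divide_simps)
  qed
  finally show ?thesis by (simp add: power_mult[symmetric] mult.commute)
qed

section \<open>Energy norms\<close>

lemma mat_norm_square:
  assumes "spd B"
  shows "(mat_norm B x)\<^sup>2 = x \<bullet> (B *v x)"
  using assms by (cases "x = 0") (auto simp: mat_norm_def spd_def less_imp_le)

lemma mat_norm_nonneg: "spd B \<Longrightarrow> 0 \<le> mat_norm B x"
  by (cases "x = 0") (auto simp: mat_norm_def spd_def less_imp_le)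

lemma mat_norm_square_add:
  assumes "spd B"
  shows "(mat_norm B (x + y))\<^sup>2 = (mat_norm B x)\<^sup>2 + 2 * (x \<bullet> (B *v y)) + (mat_norm B y)\<^sup>2"
proof -
  have "y \<bullet> (B *v x) = x \<bullet> (B *v y)"
    using assms inner_symmetric_mult[of B x y] by (simp add: spd_def inner_commute)
  then show ?thesis
    unfolding mat_norm_square[OF assms]
    by (simp add: matrix_vector_right_distrib inner_add_left inner_add_right)
qed

lemma mat_norm_le_add_orthogonal:
  assumes "spd B" "x \<bullet> (B *v y) = 0"
  shows "mat_norm B x \<le> mat_norm B (x + y)" "mat_norm B y \<le> mat_norm B (x + y)"
proof -
  have "(mat_norm B (x + y))\<^sup>2 = (mat_norm B x)\<^sup>2 + (mat_norm B y)\<^sup>2"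
    using mat_norm_square_add[OF assms(1), of x y] assms(2) by simp
  then show "mat_norm B x \<le> mat_norm B (x + y)" "mat_norm B y \<le> mat_norm B (x + y)"
    by (simp_all add: power2_le_imp_le mat_norm_nonneg[OF assms(1)])
qed

lemma mat_norm_scaleR: "mat_norm B (c *\<^sub>R x) = \<bar>c\<bar> * mat_norm B x"
proof -
  have "(c *\<^sub>R x) \<bullet> (B *v (c *\<^sub>R x)) = c\<^sup>2 * (x \<bullet> (B *v x))"
    by (simp add: matrix_vector_mult_scaleR power2_eq_square)
  then show ?thesis by (simp add: mat_norm_def real_sqrt_mult)
qed

lemma mat_norm_minus: "mat_norm B (- x) = mat_norm B x"
  using mat_norm_scaleR[of B "-1" x] by simp

text \<open>Cauchy--Schwarz for the inner product defined by \<open>B\<close>, from the nonnegativity of the square of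
  \<open>\<parallel>y\<parallel>\<^sub>B x - \<parallel>x\<parallel>\<^sub>B y\<close>.\<close>

lemma inner_le_mat_norm:
  assumes "spd B"
  shows "x \<bullet> (B *v y) \<le> mat_norm B x * mat_norm B y"
proof -
  define a b where "a = mat_norm B x" and "b = mat_norm B y"
  have ab: "0 \<le> a" "0 \<le> b" using mat_norm_nonneg[OF assms] by (auto simp: a_def b_def)
  have "0 \<le> (mat_norm B (b *\<^sub>R x + (- a) *\<^sub>R y))\<^sup>2" by simp
  also have "\<dots> = 2 * (a * b) * (a * b) - 2 * (a * b) * (x \<bullet> (B *v y))"
    unfolding mat_norm_square_add[OF assms] mat_norm_scaleR a_def[symmetric] b_def[symmetric]
    by (simp add: matrix_vector_mult_scaleR power2_eq_square algebra_simps ab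
        linear_neg[OF matrix_vector_mul_linear])
  finally have le: "(a * b) * (x \<bullet> (B *v y)) \<le> (a * b) * (a * b)" by simp
  show ?thesis
  proof (cases "a * b = 0")
    case True
    have eq_0: "v = 0" if "mat_norm B v = 0" for v
      using assms mat_norm_square[OF assms, of v] that unfolding spd_def by force
    have "x = 0 \<or> y = 0" using True eq_0 unfolding a_def b_def by auto
    then have "x \<bullet> (B *v y) = 0" by auto
    with True show ?thesis by (simp only: a_def b_def order_refl)
  next
    case False
    with ab have "0 < a * b" by (simp add: less_le)
    with le show ?thesis unfolding a_def b_def by (simp only: mult_le_cancel_left_pos)
  qed
qed

lemma mat_norm_triangle:
  assumes "spd B"
  shows "mat_norm B (x + y) \<le> mat_norm B x + mat_norm B y"
proof (rule power2_le_imp_le)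
  show "(mat_norm B (x + y))\<^sup>2 \<le> (mat_norm B x + mat_norm B y)\<^sup>2"
    unfolding mat_norm_square_add[OF assms] power2_sum
    using inner_le_mat_norm[OF assms, of x y] by simp
  show "0 \<le> mat_norm B x + mat_norm B y"
    using mat_norm_nonneg[OF assms] by (simp add: add_nonneg_nonneg)
qed

lemma inner_diagonal:
  assumes "is_diagonal D"
  shows "x \<bullet> (D *v y) = (\<Sum>i\<in>UNIV. x $ i * D $ i $ i * y $ i)"
proof -
  have "(\<Sum>j\<in>UNIV. D $ i $ j * y $ j) = D $ i $ i * y $ i" for i
  proof -
    have "(\<Sum>j\<in>UNIV. D $ i $ j * y $ j) = (\<Sum>j\<in>UNIV. if j = i then D $ i $ i * y $ i else 0)"
      using assms by (intro sum.cong) (auto simp: is_diagonal_def)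
    then show ?thesis by simp
  qed
  then show ?thesis
    by (simp add: inner_vec_def matrix_vector_mult_def mult.assoc)
qed

lemma diagonal_spd_pos:
  assumes "spd D" "is_diagonal D"
  shows "0 < D $ i $ i"
proof -
  have "0 < axis i 1 \<bullet> (D *v axis i 1)" using assms(1) unfolding spd_def by simp
  also have "\<dots> = (\<Sum>j\<in>UNIV. if j = i then D $ i $ i else 0)"
    unfolding inner_diagonal[OF assms(2)] by (intro sum.cong) (auto simp: axis_def)
  finally show ?thesis by simp
qed

text \<open>The norm \<open>\<parallel>D\<^sup>-\<^sup>1\<^sup>/\<^sup>2 y\<parallel>\<close> is dual to the \<open>D\<close>-norm: the factors \<open>D\<^sup>-\<^sup>1\<^sup>/\<^sup>2\<close> and \<open>D\<^sup>1\<^sup>/\<^sup>2\<close> may be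
  moved to the two sides of the Euclidean inner product.\<close>

lemma inner_le_dual_norm:
  fixes D :: "real^'n^'n"
  assumes "spd D" "is_diagonal D"
  shows "y \<bullet> x \<le> norm (diag_inv_sqrt D *v y) * mat_norm D x"
proof -
  define z :: "real^'n" where "z = (\<chi> i. sqrt (D $ i $ i) * x $ i)"
  have pos: "0 < D $ i $ i" for i by (rule diagonal_spd_pos[OF assms])
  have comp: "(diag_inv_sqrt D *v y) $ i = y $ i / sqrt (D $ i $ i)" for i
  proof -
    have "(\<Sum>j\<in>UNIV. (if i = j then 1 / sqrt (D $ i $ i) else 0) * y $ j)
        = (\<Sum>j\<in>UNIV. if j = i then y $ i / sqrt (D $ i $ i) else 0)"
      by (intro sum.cong) auto
    then show ?thesis by (simp add: matrix_vector_mult_def diag_inv_sqrt_def)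
  qed
  have "y \<bullet> x = (diag_inv_sqrt D *v y) \<bullet> z"
    unfolding inner_vec_def comp z_def using pos
    by (intro sum.cong refl) (simp add: less_imp_neq[THEN not_sym])
  also have "\<dots> \<le> norm (diag_inv_sqrt D *v y) * norm z" by (rule norm_cauchy_schwarz)
  also have "norm z = mat_norm D x"
    unfolding mat_norm_def inner_diagonal[OF assms(2)] norm_eq_sqrt_inner
    unfolding inner_vec_def z_def using pos by (intro arg_cong[of _ _ sqrt] sum.cong refl) (simp add: less_imp_le)
  finally show ?thesis .
qed

section \<open>Fine and coarse subspaces\<close>

text \<open>Since \<open>D\<close> is diagonal, the aggregates do not interact: the local inner product of a vector
  supported in \<open>S\<close> agrees with the global one, and vectors with disjoint supports are
  \<open>D\<close>-orthogonal. The relations that define \<open>Pp\<close> aggregate by aggregate thereby become the global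
  identities \<open>Pp\<^sup>T D Pp = I\<close> and \<open>Pp\<^sup>T D P = 0\<close>.\<close>

lemma local_inner_eq:
  assumes "is_diagonal D" "\<And>i. i \<notin> S \<Longrightarrow> x $ i = 0"
  shows "local_inner D S x y = x \<bullet> (D *v y)"
proof -
  have "(\<Sum>j\<in>S. x $ i * D $ i $ j * y $ j) = (if i \<in> S then x $ i * D $ i $ i * y $ i else 0)"
    if "i \<in> S" for i
  proof -
    have "(\<Sum>j\<in>S. x $ i * D $ i $ j * y $ j) = (\<Sum>j\<in>S. if j = i then x $ i * D $ i $ i * y $ i else 0)"
      using assms(1) by (intro sum.cong) (auto simp: is_diagonal_def)
    then show ?thesis using that by simp
  qed
  then have "local_inner D S x y = (\<Sum>i\<in>S. x $ i * D $ i $ i * y $ i)"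
    unfolding local_inner_def by simp
  also have "\<dots> = (\<Sum>i\<in>UNIV. x $ i * D $ i $ i * y $ i)"
    using assms(2) by (intro sum.mono_neutral_left) auto
  finally show ?thesis by (simp add: inner_diagonal[OF assms(1)])
qed

lemma disjoint_support_orthogonal:
  assumes "is_diagonal D" "S \<inter> T = {}"
    and "\<And>i. i \<notin> S \<Longrightarrow> x $ i = 0" "\<And>i. i \<notin> T \<Longrightarrow> y $ i = 0"
  shows "x \<bullet> (D *v y) = 0"
  unfolding inner_diagonal[OF assms(1)]
  using assms(2-4) by (intro sum.neutral) (metis disjoint_iff mult_zero_left mult_zero_right)

lemma aggregate_complement_orthonormal:
  assumes "is_diagonal D" "partition_on UNIV \<A>" "aggregate_complement \<A> cblk fblk D P Pp"
  shows "column j Pp \<bullet> (D *v column k Pp) = (if j = k then 1 else 0)"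
proof -
  have supp: "fblk j \<in> \<A>" "i \<notin> fblk j \<Longrightarrow> column j Pp $ i = 0" for i j
    using assms(3) by (auto simp: aggregate_complement_def block_diagonal_def column_def)
  show ?thesis
  proof (cases "fblk j = fblk k")
    case True
    then have "local_inner D (fblk j) (column j Pp) (column k Pp) = (if j = k then 1 else 0)"
      using assms(3) supp(1)[of j] unfolding aggregate_complement_def by simp
    then show ?thesis using local_inner_eq[OF assms(1) supp(2)] by simp
  next
    case False
    then have "fblk j \<inter> fblk k = {}"
      using assms(2) supp(1) by (auto simp: partition_on_def disjoint_def)
    then show ?thesis
      using disjoint_support_orthogonal[OF assms(1) _ supp(2) supp(2)] False by auto
  qed
qed

lemma aggregate_complement_orthogonal:
  assumes "is_diagonal D" "partition_on UNIV \<A>" "block_diagonal \<A> cblk P"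
    and "aggregate_complement \<A> cblk fblk D P Pp"
  shows "column j Pp \<bullet> (D *v column k P) = 0"
proof -
  have suppf: "fblk j \<in> \<A>" "i \<notin> fblk j \<Longrightarrow> column j Pp $ i = 0" for i j
    using assms(4) by (auto simp: aggregate_complement_def block_diagonal_def column_def)
  have suppc: "cblk k \<in> \<A>" "i \<notin> cblk k \<Longrightarrow> column k P $ i = 0" for i k
    using assms(3) by (auto simp: block_diagonal_def column_def)
  show ?thesis
  proof (cases "fblk j = cblk k")
    case True
    have "column j Pp \<in> span (block_columns fblk Pp (fblk j))"
      by (intro span_base) (auto simp: block_columns_def)
    also have "\<dots> = local_complement D (fblk j) (span (block_columns cblk P (fblk j)))"
      using assms(4) suppf(1) by (simp add: aggregate_complement_def)
    finally have "\<And>w. w \<in> span (block_columns cblk P (fblk j)) \<Longrightarrow>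
        local_inner D (fblk j) (column j Pp) w = 0"
      by (simp add: local_complement_def)
    moreover have "column k P \<in> span (block_columns cblk P (fblk j))"
      using True by (intro span_base) (auto simp: block_columns_def)
    ultimately show ?thesis using local_inner_eq[OF assms(1) suppf(2)] by simp
  next
    case False
    then have "fblk j \<inter> cblk k = {}"
      using assms(2) suppf(1) suppc(1) by (auto simp: partition_on_def disjoint_def)
    then show ?thesis
      by (rule disjoint_support_orthogonal[OF assms(1) _ suppf(2) suppc(2)])
  qed
qed

lemma transpose_mult_mult_component:
  fixes X :: "real^'a^'n" and B :: "real^'n^'n" and Y :: "real^'b^'n"
  shows "(transpose X ** B ** Y) $ j $ k = column j X \<bullet> (B *v column k Y)"
proof -
  have "(transpose X ** B ** Y) *v axis k 1 = transpose X *v (B *v (Y *v axis k 1))"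
    by (simp only: matrix_vector_mul_assoc matrix_mul_assoc)
  moreover have "((transpose X ** B ** Y) *v axis k 1) $ j = (transpose X ** B ** Y) $ j $ k"
    by (simp add: matrix_vector_mult_basis column_def)
  moreover have "(transpose X *v z) $ j = column j X \<bullet> z" for z
    by (simp add: matrix_vector_mul_component transpose_def column_def row_def del: transpose_matrix_vector)
  ultimately show ?thesis by (simp add: matrix_vector_mult_basis)
qed

text \<open>The map taking \<open>(a, b)\<close> to \<open>P a + Q b\<close> is injective: multiplication by \<open>Q\<^sup>T D\<close> recovers \<open>b\<close>, and
  then \<open>a\<close> is determined by the full rank of \<open>P\<close>. The number of columns equals the dimension of
  the space, so the map is onto.\<close>

lemma fine_coarse_decomposition:
  fixes P :: "real^'c^'n" and Q :: "real^'f^'n" and D :: "real^'n^'n"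
  assumes rank: "rank P = CARD('c)" and card: "CARD('c) \<le> CARD('n)" "CARD('f) = CARD('n) - CARD('c)"
    and QDQ: "transpose Q ** D ** Q = mat 1" and QDP: "transpose Q ** D ** P = 0"
  obtains a b where "u = P *v a + Q *v b"
proof -
  let ?F = "\<lambda>z. P *v fst z + Q *v snd z"
  have G: "(transpose Q ** D) *v (Q *v b) = b" "(transpose Q ** D) *v (P *v a) = 0" for a b
    by (simp_all only: matrix_vector_mul_assoc QDQ QDP matrix_vector_mul_lid matrix_vector_mult_0)
  have lin: "linear ?F"
    by (rule linearI) (simp_all add: matrix_vector_right_distrib matrix_vector_mult_scaleR scaleR_add_right)
  have "z = 0" if "?F z = 0" for z
  proof -
    have "snd z = (transpose Q ** D) *v ?F z"
      by (simp only: matrix_vector_right_distrib G) simp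
    then have snd: "snd z = 0" using that by (simp only: matrix_vector_mult_0_right)
    with that have "P *v fst z = P *v 0" by simp
    then have "fst z = 0" using rank by (simp only: full_rank_injective inj_eq)
    with snd show ?thesis by (simp add: prod_eq_iff)
  qed
  then have "inj ?F" using linear_injective_0[OF lin] by blast
  then have "dim (range ?F) = dim (UNIV :: ((real^'c) \<times> (real^'f)) set)"
    by (intro dim_image_eq lin) (auto intro: inj_on_subset)
  also have "\<dots> = DIM(real^'n)" using card by simp
  finally have "span (range ?F) = UNIV" by (simp only: dim_eq_full)
  then have "range ?F = UNIV"
    using linear_subspace_image[OF lin subspace_UNIV] by (simp only: span_eq_iff[THEN iffD2])
  then obtain z where "u = ?F z" by blast
  then show ?thesis by (rule that)
qed

section \<open>Error of the approximate ideal prolongation\<close>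

text \<open>The Galerkin equation says that the error is \<open>A\<close>-orthogonal to the range of \<open>R\<close>, and any other
  candidate differs from the Galerkin solution by an element of that range.\<close>

lemma galerkin_optimal:
  fixes A :: "real^'n^'n" and R :: "real^'c^'n"
  assumes "spd A" and eq: "(transpose R ** A ** R) *v z = transpose R *v (A *v u)"
  shows "mat_norm A (u - R *v z) \<le> mat_norm A (u - R *v w)"
proof -
  have "transpose R *v (A *v (u - R *v z)) = 0"
    using eq by (simp only: matrix_vector_mult_diff_distrib matrix_vector_mul_assoc matrix_mul_assoc diff_self)
  then have orth: "(R *v y) \<bullet> (A *v (u - R *v z)) = 0" for y
    by (rule inner_range_eq_0)
  have decomp: "R *v (z - w) + (u - R *v z) = u - R *v w"
    by (simp add: matrix_vector_mult_diff_distrib)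
  have "mat_norm A (u - R *v z) \<le> mat_norm A (R *v (z - w) + (u - R *v z))"
    by (rule mat_norm_le_add_orthogonal(2)[OF assms(1) orth])
  then show ?thesis by (simp only: decomp)
qed

lemma mat_norm_fine:
  "mat_norm A (Q *v x) = mat_norm (fine_matrix A Q) x"
proof -
  have "x \<bullet> (fine_matrix A Q *v x) = (transpose Q *v (A *v (Q *v x))) \<bullet> x"
    unfolding fine_matrix_def by (simp only: matrix_vector_mul_assoc matrix_mul_assoc inner_commute)
  also have "\<dots> = (Q *v x) \<bullet> (A *v (Q *v x))"
    unfolding inner_transpose_mult by (rule inner_commute)
  finally show ?thesis by (simp only: mat_norm_def)
qed

lemma transpose_fine_matrix:
  assumes "transpose A = A" shows "transpose (fine_matrix A Q) = fine_matrix A Q"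
  unfolding fine_matrix_def by (simp add: matrix_transpose_mul assms matrix_mul_assoc)

lemma fine_solve:
  fixes M :: "real^'f^'f"
  assumes "\<not> is_eigenvalue M 0"
  obtains g where "M *v g = b"
proof -
  have "\<And>x. M *v x = 0 \<Longrightarrow> x = 0" using assms unfolding is_eigenvalue_def by fastforce
  then have "inj ((*v) M)" using linear_injective_0[OF matrix_vector_mul_linear] by blast
  then have "surj ((*v) M)" by (intro linear_injective_imp_surjective) auto
  then show ?thesis using that by (metis surjD)
qed

text \<open>The polynomial \<open>t (\<eta>\<^sup>2 t - 1)\<close> is nonnegative on the spectrum; its quadratic form at \<open>g\<close> is
  \<open>\<eta>\<^sup>2 \<parallel>M g\<parallel>\<^sup>2 - \<parallel>g\<parallel>\<^sub>M\<^sup>2\<close>.\<close>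

lemma mat_norm_le_norm_residual:
  fixes M :: "real^'f^'f"
  assumes "transpose M = M" "0 < \<eta>" and eig: "\<And>\<mu>. is_eigenvalue M \<mu> \<Longrightarrow> 1 / \<eta>\<^sup>2 \<le> \<mu>"
  shows "mat_norm M g \<le> \<eta> * norm (M *v g)"
proof -
  let ?h = "[:0, 1:] * ([:\<eta>\<^sup>2:] * [:0, 1:] - 1)"
  have "0 \<le> poly ?h \<mu>" if "is_eigenvalue M \<mu>" for \<mu>
  proof -
    have "0 < 1 / \<eta>\<^sup>2" using \<open>0 < \<eta>\<close> by simp
    then have "0 \<le> \<mu>" using eig[OF that] by linarith
    moreover have "0 \<le> \<eta>\<^sup>2 * \<mu> - 1" using eig[OF that] \<open>0 < \<eta>\<close> by (simp add: field_simps)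
    ultimately have "0 \<le> \<mu> * (\<eta>\<^sup>2 * \<mu> - 1)" by (rule mult_nonneg_nonneg)
    then show ?thesis by (simp add: algebra_simps)
  qed
  from poly_mat_nonneg[OF assms(1) this, of g]
  have "0 \<le> \<eta>\<^sup>2 * (g \<bullet> (M *v (M *v g))) - g \<bullet> (M *v g)"
    by (simp only: poly_mat_mult poly_mat_diff poly_mat_X poly_mat_const poly_mat_1
        matrix_vector_mult_diff_distrib matrix_vector_mult_scaleR inner_diff_right inner_scaleR_right)
  then have "g \<bullet> (M *v g) \<le> (\<eta> * norm (M *v g))\<^sup>2"
    by (simp add: inner_symmetric_mult[OF assms(1), symmetric] power_mult_distrib dot_square_norm)
  then show ?thesis
    unfolding mat_norm_def using \<open>0 < \<eta>\<close> by (intro real_le_lsqrt) auto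
qed

text \<open>The polynomial \<open>c\<^sup>2 t - p t p\<close> is nonnegative on the spectrum; its quadratic form at \<open>g\<close> is
  \<open>c\<^sup>2 \<parallel>g\<parallel>\<^sub>M\<^sup>2 - \<parallel>p(M) g\<parallel>\<^sub>M\<^sup>2\<close>.\<close>

lemma mat_norm_poly_mat_le:
  fixes M :: "real^'f^'f"
  assumes "transpose M = M" "0 \<le> c"
    and eig: "\<And>\<mu>. is_eigenvalue M \<mu> \<Longrightarrow> 0 \<le> \<mu> \<and> \<bar>poly p \<mu>\<bar> \<le> c"
  shows "mat_norm M (poly_mat p M *v g) \<le> c * mat_norm M g"
proof -
  let ?h = "[:c\<^sup>2:] * [:0, 1:] - p * ([:0, 1:] * p)"
  have "0 \<le> poly ?h \<mu>" if "is_eigenvalue M \<mu>" for \<mu>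
  proof -
    have "(poly p \<mu>)\<^sup>2 \<le> c\<^sup>2" using eig[OF that] by (simp add: abs_le_square_iff[symmetric] \<open>0 \<le> c\<close>)
    then have "0 \<le> \<mu> * (c\<^sup>2 - (poly p \<mu>)\<^sup>2)" using eig[OF that] by simp
    then show ?thesis by (simp add: algebra_simps power2_eq_square)
  qed
  from poly_mat_nonneg[OF assms(1) this, of g]
  have "0 \<le> c\<^sup>2 * (g \<bullet> (M *v g)) - g \<bullet> (poly_mat p M *v (M *v (poly_mat p M *v g)))"
    by (simp only: poly_mat_mult poly_mat_diff poly_mat_X poly_mat_const
        inner_diff_right inner_scaleR_right)
  then have "(poly_mat p M *v g) \<bullet> (M *v (poly_mat p M *v g)) \<le> c\<^sup>2 * (g \<bullet> (M *v g))"
    by (simp add: inner_symmetric_mult[OF transpose_poly_mat[OF assms(1)]])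
  then have "mat_norm M (poly_mat p M *v g) \<le> sqrt (c\<^sup>2 * (g \<bullet> (M *v g)))"
    unfolding mat_norm_def by (rule real_sqrt_le_mono)
  then show ?thesis using \<open>0 \<le> c\<close> by (simp add: mat_norm_def real_sqrt_mult)
qed

text \<open>The candidate is the image under the prolongation of the coarse part \<open>a\<close> of \<open>u\<close>, and \<open>c\<close> bounds \<open>p\<close> on the spectrum of the fine matrix.
  The factor \<open>\<eta>\<close> arises from the spectrum of the fine matrix in the first term, and from weak
  approximation in the second.\<close>

lemma approx_ideal_prolongation_bound:
  fixes A D :: "real^'n^'n" and P :: "real^'c^'n" and Q :: "real^'f^'n"
  assumes A: "spd A" and D: "spd D" "is_diagonal D"
    and AD: "\<And>v. v \<bullet> (A *v v) \<le> v \<bullet> (D *v v)"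
    and QDQ: "transpose Q ** D ** Q = mat 1" and QDP: "transpose Q ** D ** P = 0"
    and \<eta>: "0 < \<eta>" and wap: "weak_approximation A D P \<eta>"
    and eig: "\<And>\<mu>. is_eigenvalue (fine_matrix A Q) \<mu> \<Longrightarrow> 1 / \<eta>\<^sup>2 \<le> \<mu> \<and> \<bar>poly p \<mu>\<bar> \<le> c"
    and c: "0 \<le> c" and p: "p = 1 - [:0, 1:] * q" and u: "u = P *v a + Q *v b"
  shows "mat_norm A (u - approx_ideal_prolongation A P Q q *v a)
      \<le> \<eta> * norm (diag_inv_sqrt D *v (A *v u)) + c * \<eta> * mat_norm A u"
proof -
  let ?M = "fine_matrix A Q"
  have symA: "transpose A = A" using A by (simp add: spd_def)
  have symM: "transpose ?M = ?M" by (rule transpose_fine_matrix[OF symA])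
  have M: "?M *v x = transpose Q *v (A *v (Q *v x))" for x
    unfolding fine_matrix_def by (simp only: matrix_vector_mul_assoc matrix_mul_assoc)
  have low: "0 < 1 / \<eta>\<^sup>2" using \<eta> by simp
  then have "\<not> is_eigenvalue ?M 0" using eig by fastforce
  then obtain g' where g': "?M *v g' = transpose Q *v (A *v (P *v a))" by (rule fine_solve)
  define g where "g = g' + b"
  have g: "?M *v g = transpose Q *v (A *v u)"
    by (simp only: g_def u matrix_vector_right_distrib g') (simp only: M)

  have "poly_mat p ?M *v g' = g' - poly_mat q ?M *v (?M *v g')"
    unfolding p by (simp only: poly_mat_diff poly_mat_mult poly_mat_1 poly_mat_X poly_mat_commute)
  moreover have "approx_ideal_prolongation A P Q q *v a
      = P *v a - Q *v (poly_mat q ?M *v (?M *v g'))"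
    unfolding approx_ideal_prolongation_def approx_proj_def g'
    by (simp only: matrix_vector_mul_assoc[symmetric] matrix_vector_mult_diff_rdistrib matrix_vector_mul_lid)
  ultimately have decomp: "u - approx_ideal_prolongation A P Q q *v a
      = Q *v g + - (Q *v (poly_mat p ?M *v g'))"
    by (simp add: u g_def matrix_vector_right_distrib matrix_vector_mult_diff_distrib)

  have first: "mat_norm A (Q *v g) \<le> \<eta> * norm (diag_inv_sqrt D *v (A *v u))"
  proof -
    define z where "z = transpose Q *v (A *v u)"
    have DQ: "mat_norm D (Q *v x) = norm x" for x
      unfolding mat_norm_fine[of D] fine_matrix_def QDQ
      by (simp add: mat_norm_def norm_eq_sqrt_inner)
    have "norm z * norm z = z \<bullet> z" by (simp only: dot_square_norm power2_eq_square)
    also have "\<dots> = (A *v u) \<bullet> (Q *v z)"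
      unfolding z_def by (rule inner_transpose_mult)
    also have "\<dots> \<le> norm (diag_inv_sqrt D *v (A *v u)) * norm z"
      using inner_le_dual_norm[OF D, of "A *v u" "Q *v z"] by (simp only: DQ)
    finally have "norm z \<le> norm (diag_inv_sqrt D *v (A *v u))"
      by (cases "norm z = 0") (simp_all add: mult_le_cancel_right)
    moreover have "mat_norm A (Q *v g) \<le> \<eta> * norm z"
      unfolding mat_norm_fine[of A Q] z_def g[symmetric]
      by (rule mat_norm_le_norm_residual[OF symM \<eta>]) (use eig in blast)
    ultimately show ?thesis using \<eta> by (meson mult_left_mono less_imp_le order_trans)
  qed

  \<comment> \<open>Weak approximation is applied not to \<open>u\<close> but to \<open>x = u - Q g\<close>, whose \<open>D\<close>-orthogonal
    components along the ranges of \<open>P\<close> and \<open>Q\<close> are \<open>P a\<close> and \<open>- Q g'\<close>.\<close>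
  have second: "mat_norm A (Q *v g') \<le> \<eta> * mat_norm A u"
  proof -
    define x where "x = u - Q *v g"
    have "transpose Q *v (A *v x) = 0"
      by (simp only: x_def matrix_vector_mult_diff_distrib M[symmetric] g diff_self)
    then have orthA: "(Q *v y) \<bullet> (A *v x) = 0" for y
      by (rule inner_range_eq_0)
    have xP: "x = P *v a - Q *v g'"
      by (simp add: x_def u g_def matrix_vector_right_distrib)
    obtain w where w: "mat_norm D (x - P *v w) \<le> \<eta> * mat_norm A x"
      using wap unfolding weak_approximation_def by blast
    have orthD: "(Q *v y) \<bullet> (D *v (P *v t)) = 0" for y t
    proof -
      have "transpose Q *v (D *v (P *v t)) = 0"
        by (simp only: matrix_vector_mul_assoc matrix_mul_assoc QDP matrix_vector_mult_0)
      then show ?thesis by (rule inner_range_eq_0)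
    qed
    have "mat_norm A (Q *v g') \<le> mat_norm D (Q *v g')"
      unfolding mat_norm_def using AD by (rule real_sqrt_le_mono)
    also have "\<dots> = mat_norm D (Q *v (- g'))"
      by (simp add: linear_neg[OF matrix_vector_mul_linear] mat_norm_minus)
    also have "\<dots> \<le> mat_norm D (Q *v (- g') + P *v (a - w))"
      by (rule mat_norm_le_add_orthogonal(1)[OF D(1) orthD])
    also have "Q *v (- g') + P *v (a - w) = x - P *v w"
      by (simp add: xP matrix_vector_mult_diff_distrib linear_neg[OF matrix_vector_mul_linear])
    also note w
    also have "mat_norm A x \<le> mat_norm A u"
      using mat_norm_le_add_orthogonal(2)[OF A orthA, of g] by (simp add: x_def)
    finally show ?thesis using \<eta> by simp
  qed

  have "mat_norm A (Q *v (poly_mat p ?M *v g')) \<le> c * mat_norm A (Q *v g')"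
    unfolding mat_norm_fine[of A Q]
    by (rule mat_norm_poly_mat_le[OF symM c]) (use eig low in \<open>meson less_imp_le order_trans\<close>)
  also have "\<dots> \<le> c * (\<eta> * mat_norm A u)"
    using second c by (rule mult_left_mono)
  finally have "mat_norm A (Q *v (poly_mat p ?M *v g')) \<le> c * \<eta> * mat_norm A u" by simp
  with first show ?thesis
    using mat_norm_triangle[OF A, of "Q *v g" "- (Q *v (poly_mat p ?M *v g'))"]
    unfolding decomp mat_norm_minus by linarith
qed

theorem theorem4p8:
  fixes A D :: "real^'n^'n"
    and P Pt :: "real^'c^'n"
    and Pp :: "real^'f^'n"
    and \<A> :: "'n set set"
    and cblk :: "'c \<Rightarrow> 'n set"
    and fblk :: "'f \<Rightarrow> 'n set"
    and \<eta> \<alpha> \<beta> r :: real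
    and \<nu> :: nat
    and p q :: "real poly"
    and f u :: "real^'n"
    and u\<^sub>c :: "real^'c"
  assumes "CARD('c) < CARD('n)"
    and "CARD('f) = CARD('n) - CARD('c)"
    and "spd A"
    and "spd D" and "is_diagonal D"
    and "\<And>v. v \<bullet> (A *v v) \<le> v \<bullet> (D *v v)"
    and "partition_on UNIV \<A>"
    and "block_diagonal \<A> cblk P"
    and "rank P = CARD('c)"
    and "aggregate_complement \<A> cblk fblk D P Pp"
    and "\<eta> > 0"
    and "weak_approximation A D P \<eta>"
    and "\<And>\<mu>. is_eigenvalue (fine_matrix A Pp) \<mu> \<Longrightarrow> \<mu> \<in> {\<alpha>..\<beta>}"
    and "{\<alpha>..\<beta>} \<subseteq> {1 / \<eta>\<^sup>2..1}"
    and "\<alpha> < \<beta>"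
    and "\<nu> \<ge> 1"
    and "p = cheb_scaled \<nu> \<alpha> \<beta>"
    and "degree q = \<nu> - 1"
    and "p = 1 - [:0, 1:] * q"
    and "Pt = approx_ideal_prolongation A P Pp q"
    and "A *v u = f"
    and "(transpose Pt ** A ** Pt) *v u\<^sub>c = transpose Pt *v f"
    and "r = (\<eta> - 1) / (\<eta> + 1)"
  shows "mat_norm A (u - Pt *v u\<^sub>c)
         \<le> \<eta> * norm (diag_inv_sqrt D *v (A *v u))
           + 2 * r ^ \<nu> * \<eta> / (1 + r ^ (2 * \<nu>)) * mat_norm A u"
proof -
  have QDQ: "transpose Pp ** D ** Pp = mat 1"
    by (simp add: vec_eq_iff transpose_mult_mult_component mat_def
        aggregate_complement_orthonormal[OF assms(5,7,10)])
  have QDP: "transpose Pp ** D ** P = 0"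
    by (simp add: vec_eq_iff transpose_mult_mult_component
        aggregate_complement_orthogonal[OF assms(5,7,8,10)])
  obtain a b where u: "u = P *v a + Pp *v b"
    by (rule fine_coarse_decomposition[OF assms(9) _ assms(2) QDQ QDP]) (use assms(1) in auto)
  have ab: "1 / \<eta>\<^sup>2 \<le> \<alpha>" "\<beta> \<le> 1" using assms(14,15) by auto
  define c where "c = 2 * r ^ \<nu> / (1 + r ^ (2 * \<nu>))"
  have p_le: "\<bar>poly p t\<bar> \<le> c" if "\<alpha> \<le> t" "t \<le> \<beta>" for t
    unfolding assms(17) c_def
    by (rule abs_poly_cheb_scaled_le[OF assms(11,15) ab that assms(23)])
  have "0 \<le> c" using p_le[of \<alpha>] assms(15) by linarith
  have eig: "1 / \<eta>\<^sup>2 \<le> \<mu> \<and> \<bar>poly p \<mu>\<bar> \<le> c" if "is_eigenvalue (fine_matrix A Pp) \<mu>" for \<mu>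
    using assms(13)[OF that] p_le ab(1) by auto
  have "mat_norm A (u - Pt *v u\<^sub>c) \<le> mat_norm A (u - Pt *v a)"
    by (rule galerkin_optimal[OF assms(3)]) (simp only: assms(21,22))
  also have "\<dots> \<le> \<eta> * norm (diag_inv_sqrt D *v (A *v u)) + c * \<eta> * mat_norm A u"
    unfolding assms(20)
    by (rule approx_ideal_prolongation_bound[OF assms(3-6) QDQ QDP assms(11,12) eig \<open>0 \<le> c\<close> assms(19) u])
  finally show ?thesis by (simp add: c_def)
qed

end
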